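(* Let $\mathcal X$ and $\mathcal Y$ be Hausdorff topological vector spaces, let $\mathcal X^*$ be the topological dual of $\mathcal X$, and endow $\mathcal X$ with the weak topology. Let $C_b(\mathcal Y)$ be the set of all bounded continuous functions $\varphi:\mathcal Y\to\mathbb R$. Assume that the random variables $X_n\in\mathcal X$ and $Y_n\in\mathcal Y$ ($n\ge 1$) are defined on the same probability space, and that the two sequences $(X_n)$ and $(Y_n)$ are exponentially tight (with speed $n$). Assume further that: 1. There is a set $D\subset\mathcal X^*$ and functions $G_X:D\to\mathbb R$, $J:C_b(\mathcal Y)\to\mathbb R$ such that for all $x^*\in D$ and all $\varphi\in C_b(\mathcal Y)$ $$\lim_{n\to\infty}\frac1n\log\mathbb E\exp\left(n\langle x^*,X_n\rangle+n\varphi(Y_n)\right)=G_X(x^* )+J(\varphi).$$ 2. Let $$G_X^*(x)=\sup_{x^*\in D}\{\langle x^*,x\rangle-G_X(x^* )\},\qquad x\in\mathcal X,$$ and let $\mathcal F$ denote the set of exposed points $x$ of $G_X^*$ with an exposing hyperplane $x^*$ satisfying $x^*\in D$ and $\gamma x^*\in D$ for some $\gamma>1$. Then for every $x\in\{G_X^*<\infty\}$ there exists a sequence $(x_k)_k$ with $x_k\in\mathcal F$ such that $\lim_{k\to\infty}x_k=x$ and $$\lim_{k\to\infty}G_X^*(x_k)=G_X^*(x).$$ Then the pair $(X_n,Y_n)$ satisfies the large deviation principle in $\mathcal X\times\mathcal Y$ with speed $n$ and good rate function $$\mathcal I(x,y)=G_X^*(x)+\mathcal I_Y(y),$$ where $$\mathcal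 I_Y(y)=\sup_{\varphi\in C_b(\mathcal Y)}\{\varphi(y)-J(\varphi)\}.$$
   Context: A point $x\in\mathcal X$ is called an exposed point of a function $F$ on $\mathcal X$ if there exists $x^*\in\mathcal X^*$ (called an exposing hyperplane for $x$) such that $$F(x)-\langle x^*,x\rangle<F(z)-\langle x^*,z\rangle\quad\text{for all } z\neq x.$$ Here $\langle x^*,x\rangle$ denotes the value of $x^*\in\mathcal X^*$ at $x\in\mathcal X$. All topological notions on $\mathcal X$ (convergence, compactness, open and closed sets) refer to the weak topology, and $\mathcal X\times\mathcal Y$ carries the product topology. Large deviation conventions (standard). A sequence $(Z_n)$ of random variables in a topological space $\mathcal Z$ is exponentially tight (with speed $n$) if for every $a<\infty$ there is a compact set $K_a\subset\mathcal Z$ with $\limsup_{n\to\infty}\frac1n\log\mathbb P(Z_n\in K_a^c)<-a$. A function $\mathcal I:\mathcal Z\to[0,\infty]$ is a good rate function if all level sets $\{\mathcal I\le a\}$, $a<\infty$, are compact and closed. The sequence $(Z_n)$ satisfies the large deviation principle with speed $n$ and rate function $\mathcal I$ if $\limsup_{n\to\infty}\frac1n\log\mathbb P(Z_n\in C)\le-\inf_{C}\mathcal I$ for every closed set $C$ and $\liminf_{n\to\infty}\frac1n\log\mathbb P(Z_n\in O)\ge-\inf_{O}\mathcal I$ for every open set $O$. *)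

theory Defs
  imports "HOL-Probability.Probability"
begin

section \<open>Topological vector spaces and the weak topology\<close>

class hausdorff_tvs = real_vector + t2_space + topological_ab_group_add +
  assumes tendsto_scaleR_joint:
    "((\<lambda>p. fst p *\<^sub>R snd p) \<longlongrightarrow> c *\<^sub>R x) (nhds c \<times>\<^sub>F nhds x)"

definition topological_dual :: "('a::hausdorff_tvs \<Rightarrow> real) set" where
  "topological_dual = {f. linear f \<and> continuous_on UNIV f}"

text \<open>The original topology of a type \<open>'a\<close> is the one of the type class (\<open>open\<close>, or
  \<open>euclidean\<close> as an abstract topology; despite its name the latter only means the class topology).
  The weak topology is a second topology on the same type. It need not be Hausdorff, since the dual
  of a Hausdorff topological vector space need not separate points.\<close>

definition weak_topology :: "'a::hausdorff_tvs topology" where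
  "weak_topology = topology_generated_by {f -` U | f U. f \<in> topological_dual \<and> open U}"

lemma topspace_weak_topology [simp]: "topspace weak_topology = (UNIV :: 'a::hausdorff_tvs set)"
proof -
  have "(\<lambda>x::'a. 0) \<in> topological_dual"
    by (auto simp: topological_dual_def intro!: linearI)
  then have "(\<lambda>x::'a. 0::real) -` UNIV \<in> {f -` U | f U. f \<in> topological_dual \<and> open U}"
    by blast
  then show ?thesis
    unfolding weak_topology_def topology_generated_by_topspace by auto
qed

section \<open>Exposed points\<close>

definition exposing_hyperplane ::
    "('a::hausdorff_tvs \<Rightarrow> ereal) \<Rightarrow> 'a \<Rightarrow> ('a \<Rightarrow> real) \<Rightarrow> bool" where
  "exposing_hyperplane F x f \<longleftrightarrow>
     f \<in> topological_dual \<and> (\<forall>z. z \<noteq> x \<longrightarrow> F x - ereal (f x) < F z - ereal (f z))"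

section \<open>Large deviations with speed \<open>n\<close>\<close>

text \<open>Logarithm on \<open>[0,\<infinity>]\<close> with values \<open>-\<infinity>\<close> at \<open>0\<close> and \<open>\<infinity>\<close> at \<open>\<infinity>\<close>.\<close>

definition elog :: "ennreal \<Rightarrow> ereal" where
  "elog p = (if p = 0 then -\<infinity> else if p = \<infinity> then \<infinity> else ereal (ln (enn2real p)))"

definition borel_of :: "'z topology \<Rightarrow> 'z measure" where
  "borel_of T = sigma (topspace T) {U. openin T U}"

definition random_element :: "'w measure \<Rightarrow> 'z topology \<Rightarrow> ('w \<Rightarrow> 'z) \<Rightarrow> bool" where
  "random_element M T Z \<longleftrightarrow> Z \<in> measurable M (borel_of T)"

abbreviation log_prob_rate :: "'w measure \<Rightarrow> (nat \<Rightarrow> 'w \<Rightarrow> 'z) \<Rightarrow> 'z set \<Rightarrow> nat \<Rightarrow> ereal" where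
  "log_prob_rate M Z A n \<equiv> ereal (1 / real n) * elog (emeasure M {\<omega> \<in> space M. Z n \<omega> \<in> A})"

text \<open>The measurability conjunct is automatic for random elements of a Hausdorff space, where
  compact sets are closed. In general it is needed because \<open>emeasure\<close> assigns the value \<open>0\<close> to
  sets that are not measurable.\<close>

definition exponentially_tight ::
    "'w measure \<Rightarrow> 'z topology \<Rightarrow> (nat \<Rightarrow> 'w \<Rightarrow> 'z) \<Rightarrow> bool" where
  "exponentially_tight M T Z \<longleftrightarrow>
     (\<forall>a::real. \<exists>K. compactin T K \<and>
        (\<forall>n\<ge>1. {\<omega> \<in> space M. Z n \<omega> \<in> topspace T - K} \<in> sets M) \<and>
        limsup (log_prob_rate M Z (topspace T - K)) < - ereal a)"

definition good_rate_function :: "'z topology \<Rightarrow> ('z \<Rightarrow> ereal) \<Rightarrow> bool" where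
  "good_rate_function T I \<longleftrightarrow>
     (\<forall>z \<in> topspace T. 0 \<le> I z) \<and>
     (\<forall>a::real. compactin T {z \<in> topspace T. I z \<le> ereal a} \<and>
                closedin T {z \<in> topspace T. I z \<le> ereal a})"

definition satisfies_LDP ::
    "'w measure \<Rightarrow> 'z topology \<Rightarrow> (nat \<Rightarrow> 'w \<Rightarrow> 'z) \<Rightarrow> ('z \<Rightarrow> ereal) \<Rightarrow> bool" where
  "satisfies_LDP M T Z I \<longleftrightarrow>
     (\<forall>C. closedin T C \<longrightarrow> limsup (log_prob_rate M Z C) \<le> - (INF z\<in>C. I z)) \<and>
     (\<forall>O'. openin T O' \<longrightarrow> liminf (log_prob_rate M Z O') \<ge> - (INF z\<in>O'. I z))"

section \<open>The transforms and the rate function\<close>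

definition GX_star :: "('a::hausdorff_tvs \<Rightarrow> real) set \<Rightarrow> (('a \<Rightarrow> real) \<Rightarrow> real) \<Rightarrow> 'a \<Rightarrow> ereal" where
  "GX_star D G x = (SUP f\<in>D. ereal (f x - G f))"

definition exposed_set :: "('a::hausdorff_tvs \<Rightarrow> real) set \<Rightarrow> (('a \<Rightarrow> real) \<Rightarrow> real) \<Rightarrow> 'a set" where
  "exposed_set D G =
     {x. \<exists>f\<in>D. exposing_hyperplane (GX_star D G) x f \<and> (\<exists>\<gamma>>1. (\<lambda>z. \<gamma> * f z) \<in> D)}"

text \<open>\<open>bcontfun\<close> is the set of all bounded continuous functions on the whole type.\<close>

definition IY :: "(('b::topological_space \<Rightarrow> real) \<Rightarrow> real) \<Rightarrow> 'b \<Rightarrow> ereal" where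
  "IY J y = (SUP \<phi>\<in>bcontfun. ereal (\<phi> y - J \<phi>))"

end

theory Submission
  imports Defs
begin

text \<open>Every estimate compares tilted masses \<open>E[exp (n f(X\<^sub>n) + n \<phi>(Y\<^sub>n)); (X\<^sub>n, Y\<^sub>n) \<in> A]\<close> for different
  pairs \<open>(f, \<phi>)\<close>: by a Chernoff bound, each point of a closed set has a neighbourhood of small mass,
  and exponential tightness reduces closed sets to compact ones. With \<open>f = 0\<close>, \<open>\<phi> = 0\<close> this is the upper
  bound. For the lower bound at \<open>(x, y)\<close> one tilts by a hyperplane \<open>f\<close> exposing \<open>x\<close> and by a function
  \<open>\<phi>\<close> with a high peak at \<open>y\<close>. Such \<open>\<phi>\<close> exist because topological groups are completely regular. As the
  limit splits into \<open>G f + J \<phi>\<close>, outside any neighbourhood of \<open>(x, y)\<close> the tilted mass is exponentially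
  smaller than the total one; the assumption on \<open>\<gamma>f\<close> gives the compact exhaustion of the tilted mass.
  Approximation by exposed points then yields the full lower bound, and the lower bound for the whole
  space yields that the rate function is nonnegative.\<close>

subsection \<open>Urysohn functions on topological abelian groups\<close>

text \<open>The first term \<open>w (Suc k)\<close> and the remaining sum both lie in
  \<open>V (Suc k)\<close>, so together they lie in \<open>V k\<close>; hence the induction
  generalises over \<open>k\<close>.\<close>

lemma sum_halving_neighbourhoods:
  fixes V :: "nat \<Rightarrow> 'a::comm_monoid_add set"
  assumes "\<And>i. w i \<in> V i" "\<And>i u v. u \<in> V (Suc i) \<Longrightarrow> v \<in> V (Suc i) \<Longrightarrow> u + v \<in> V i"
    and "\<And>i. 0 \<in> V i"
  shows "(\<Sum>j<N. w (Suc k + j)) \<in> V k"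
proof (induction N arbitrary: k)
  case 0
  then show ?case using assms(3) by simp
next
  case (Suc N)
  have "(\<Sum>j<N. w (Suc (Suc k) + j)) \<in> V (Suc k)" by (rule Suc.IH)
  then have "w (Suc k) + (\<Sum>j<N. w (Suc (Suc k) + j)) \<in> V k"
    using assms(1,2) by blast
  then show ?case by (subst sum.lessThan_Suc_shift) simp
qed

text \<open>A single entry of index \<open>0\<close> already has weight \<open>1\<close>. Positive
  indices are what allows two equal ones to be merged into their predecessor.\<close>

lemma dyadic_weight_less_one:
  fixes xs :: "(nat \<times> 'a) list"
  assumes "(\<Sum>p\<leftarrow>xs. (1/2::real) ^ fst p) < 1" "p \<in> set xs"
  shows "fst p \<noteq> 0"
proof
  assume "fst p = 0"
  obtain ys zs where "xs = ys @ p # zs" using assms(2) by (meson split_list)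
  moreover have "0 \<le> (\<Sum>p\<leftarrow>ys. (1/2::real) ^ fst p)" "0 \<le> (\<Sum>p\<leftarrow>zs. (1/2::real) ^ fst p)"
    by (auto intro!: sum_list_nonneg)
  ultimately show False using assms(1) \<open>fst p = 0\<close> by simp
qed

text \<open>Two summands with the same index \<open>i\<close> can be merged into one with index \<open>i - 1\<close> without changing
  the total weight, so one may assume that the indices are distinct.\<close>

lemma sum_list_halving_neighbourhoods:
  fixes V :: "nat \<Rightarrow> 'a::ab_group_add set"
  assumes V: "\<And>i u v. u \<in> V (Suc i) \<Longrightarrow> v \<in> V (Suc i) \<Longrightarrow> u + v \<in> V i" "\<And>i. 0 \<in> V i"
    and "\<forall>p\<in>set xs. snd p \<in> V (fst p)" "(\<Sum>p\<leftarrow>xs. (1/2::real) ^ fst p) < 1"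
  shows "sum_list (map snd xs) \<in> V 0"
  using assms(3,4)
proof (induction xs rule: length_induct)
  case (1 xs)
  note w = "1.prems"(2)
  show ?case
  proof (cases "distinct (map fst xs)")
    case False
    then obtain as bs cs i where "map fst xs = as @ [i] @ bs @ [i] @ cs"
      using not_distinct_decomp by blast
    then obtain as bs cs u v where xs: "xs = as @ (i, u) # bs @ (i, v) # cs"
      by (auto simp: map_eq_append_conv map_eq_Cons_conv append_eq_map_conv Cons_eq_map_conv)
    from dyadic_weight_less_one[OF w, of "(i, u)"] obtain j where j: "i = Suc j"
      by (cases i) (auto simp: xs)
    let ?ys = "(j, u + v) # as @ bs @ cs"
    have "length ?ys < length xs" by (simp add: xs)
    moreover have "\<forall>p\<in>set ?ys. snd p \<in> V (fst p)"
      using "1.prems"(1) V(1) by (auto simp: xs j)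
    moreover have "(\<Sum>p\<leftarrow>?ys. (1/2::real) ^ fst p) < 1"
      using w by (simp add: xs j)
    ultimately have "sum_list (map snd ?ys) \<in> V 0"
      using "1.IH" by blast
    then show ?thesis by (simp add: xs algebra_simps)
  next
    case True
    \<comment> \<open>Missing indices are filled with \<open>0\<close>, which lies in every
      \<open>V i\<close>.\<close>
    define w where "w i = (case map_of xs i of None \<Rightarrow> 0 | Some v \<Rightarrow> v)" for i
    have wV: "w i \<in> V i" for i
      using V(2) "1.prems"(1) by (auto simp: w_def split: option.split dest!: map_of_SomeD)
    have ws: "w (fst p) = snd p" if "p \<in> set xs" for p
      using map_of_is_SomeI[OF True, of "fst p" "snd p"] that by (simp add: w_def)
    have w0: "w i = 0" if "i \<notin> fst ` set xs" for i
      using that by (metis map_of_eq_None_iff option.simps(4) w_def)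
    obtain N where N: "fst ` set xs \<subseteq> {..<N}"
      using finite_nat_bounded[of "fst ` set xs"] by auto
    have "sum_list (map snd xs) = sum snd (set xs)"
      using True by (simp add: distinct_map sum_list_distinct_conv_sum_set)
    also have "\<dots> = sum w (fst ` set xs)"
      using True by (subst sum.reindex) (auto simp: distinct_map ws)
    \<comment> \<open>All indices are positive, which fits the shift by one in
      \<open>sum_halving_neighbourhoods\<close>.\<close>
    also have "\<dots> = sum w (Suc ` {..<N})"
    proof (rule sum.mono_neutral_left)
      show "fst ` set xs \<subseteq> Suc ` {..<N}"
      proof
        fix i assume i: "i \<in> fst ` set xs"
        then have "i \<noteq> 0" "i < N" using N dyadic_weight_less_one[OF "1.prems"(2)] by auto
        then show "i \<in> Suc ` {..<N}" by (cases i) auto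
      qed
    qed (use w0 in auto)
    also have "\<dots> = (\<Sum>j<N. w (Suc 0 + j))"
      by (subst sum.reindex) auto
    also have "\<dots> \<in> V 0"
      by (rule sum_halving_neighbourhoods) (use wV V in auto)
    finally show ?thesis .
  qed
qed

text \<open>Continuity of addition at \<open>(0, 0)\<close>; the neighbourhoods for the two summands
  are intersected.\<close>

lemma halving_neighbourhood:
  fixes U :: "'a::topological_ab_group_add set"
  assumes "open U" "0 \<in> U"
  shows "\<exists>W. open W \<and> 0 \<in> W \<and> (\<forall>u\<in>W. \<forall>v\<in>W. u + v \<in> U)"
proof -
  have "\<forall>\<^sub>F p in nhds (0::'a) \<times>\<^sub>F nhds 0. fst p + snd p \<in> U"
    using topological_tendstoD[OF tendsto_add_Pair[of "0::'a" 0] assms(1)] assms(2) by simp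
  then obtain P Q where "eventually P (nhds (0::'a))" "eventually Q (nhds (0::'a))"
      "\<And>u v. P u \<Longrightarrow> Q v \<Longrightarrow> u + v \<in> U"
    by (auto simp: eventually_prod_filter)
  then show ?thesis
    unfolding eventually_nhds by (metis IntE IntI open_Int)
qed

text \<open>The function is the infimum of the weights \<open>\<Sum>2\<^sup>-\<^sup>i\<close> over all representations of a point as a
  sum of elements of halving neighbourhoods \<open>V i\<close>, cut off at \<open>1\<close>.\<close>

lemma Urysohn_topological_ab_group_add_0:
  fixes U :: "'a::topological_ab_group_add set"
  assumes "open U" "0 \<in> U"
  shows "\<exists>g. continuous_on UNIV g \<and> range g \<subseteq> {0..1::real} \<and> g 0 = 0 \<and> (\<forall>x. x \<notin> U \<longrightarrow> g x = 1)"
proof -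
  have "\<exists>V. \<forall>n. (open (V n) \<and> 0 \<in> V n \<and> V n \<subseteq> U) \<and> (\<forall>u\<in>V (Suc n). \<forall>v\<in>V (Suc n). u + v \<in> V n)"
  proof (rule dependent_nat_choice[where P = "\<lambda>_ W. open W \<and> 0 \<in> W \<and> W \<subseteq> U" and
        Q = "\<lambda>_ W W'. \<forall>u\<in>W'. \<forall>v\<in>W'. u + v \<in> W"])
    show "\<exists>W. open W \<and> 0 \<in> W \<and> W \<subseteq> U" using assms by blast
  next
    fix W :: "'a set"
    assume W: "open W \<and> 0 \<in> W \<and> W \<subseteq> U"
    then have "\<exists>W'. open W' \<and> 0 \<in> W' \<and> (\<forall>u\<in>W'. \<forall>v\<in>W'. u + v \<in> W)"
      by (intro halving_neighbourhood) auto
    then obtain W' where W': "open W'" "0 \<in> W'" "\<forall>u\<in>W'. \<forall>v\<in>W'. u + v \<in> W"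
      by blast
    then have "W' \<subseteq> W" by (metis add.right_neutral subsetI)
    then have "W' \<subseteq> U" using W by (elim conjE) (rule order_trans)
    then show "\<exists>y. (open y \<and> 0 \<in> y \<and> y \<subseteq> U) \<and> (\<forall>u\<in>y. \<forall>v\<in>y. u + v \<in> W)"
      using W' by (intro exI[of _ W'] conjI)
  qed
  then obtain V where *: "\<forall>n. (open (V n) \<and> 0 \<in> V n \<and> V n \<subseteq> U) \<and>
      (\<forall>u\<in>V (Suc n). \<forall>v\<in>V (Suc n). u + v \<in> V n)"
    by (rule exE)
  then have V: "\<And>n. open (V n)" "\<And>n. 0 \<in> V n" "\<And>n. V n \<subseteq> U"
      "\<And>n u v. u \<in> V (Suc n) \<Longrightarrow> v \<in> V (Suc n) \<Longrightarrow> u + v \<in> V n"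
    by simp_all
  define R where "R x = {\<Sum>p\<leftarrow>xs. (1/2::real) ^ fst p | xs. (\<forall>p\<in>set xs. snd p \<in> V (fst p)) \<and>
      sum_list (map snd xs) = x}" for x
  \<comment> \<open>Inserting \<open>1\<close> performs the cut-off and keeps the infimum over a
    nonempty set when \<open>R x\<close> is empty.\<close>
  define g where "g x = Inf (insert 1 (R x))" for x
  have R0: "0 \<le> s" if "s \<in> R x" for s x
    using that by (auto simp: R_def intro!: sum_list_nonneg)
  have bdd: "bdd_below (insert 1 (R x))" for x
    using R0 by (auto intro: bdd_belowI[of _ 0])
  have ge0: "0 \<le> g x" for x
    unfolding g_def using R0 by (intro cInf_greatest) auto
  have le1: "g x \<le> 1" for x
    unfolding g_def using bdd by (intro cInf_lower) auto
  have "0 \<in> R 0" unfolding R_def by (auto intro!: exI[of _ "[]"])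
  then have "g 0 \<le> 0"
    unfolding g_def using bdd by (intro cInf_lower) auto
  then have g0: "g 0 = 0" using ge0 by (simp add: order_antisym)
  have g1: "g x = 1" if "x \<notin> U" for x
  proof -
    \<comment> \<open>A representation of weight below \<open>1\<close> would place \<open>x\<close>
      in \<open>V 0\<close>, which is contained in \<open>U\<close>.\<close>
    have "1 \<le> s" if "s \<in> R x" for s
    proof (rule ccontr)
      assume "\<not> 1 \<le> s"
      then have "x \<in> V 0"
        using that sum_list_halving_neighbourhoods[of V, OF V(4) V(2)] by (auto simp: R_def)
      then show False using V(3) \<open>x \<notin> U\<close> by blast
    qed
    then have "1 \<le> g x"
      unfolding g_def by (intro cInf_greatest) auto
    then show ?thesis using le1 by (simp add: order_antisym)
  qed
  \<comment> \<open>Adjoining \<open>(i, v)\<close> to a representation of \<open>x\<close> costs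
    \<open>(1/2) ^ i\<close>.\<close>
  have step: "g (x + v) \<le> g x + (1/2) ^ i" if v: "v \<in> V i" for x v i
  proof -
    have "g (x + v) - (1/2) ^ i \<le> s" if s: "s \<in> insert 1 (R x)" for s
    proof (cases "s = 1")
      case True
      then show ?thesis using le1[of "x + v"] by (simp add: add_increasing2 diff_le_eq)
    next
      case False
      then obtain xs where "\<forall>p\<in>set xs. snd p \<in> V (fst p)" "sum_list (map snd xs) = x"
          "s = (\<Sum>p\<leftarrow>xs. (1/2::real) ^ fst p)"
        using s by (auto simp: R_def)
      then have "s + (1/2) ^ i \<in> R (x + v)"
        unfolding R_def using v by (intro CollectI exI[of _ "(i, v) # xs"]) (auto simp: algebra_simps)
      then have "g (x + v) \<le> s + (1/2) ^ i"
        unfolding g_def using bdd by (intro cInf_lower) auto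
      then show ?thesis by simp
    qed
    then have "g (x + v) - (1/2) ^ i \<le> g x"
      unfolding g_def[of x] by (intro cInf_greatest) auto
    then show ?thesis by simp
  qed
  have "(g \<longlongrightarrow> g x) (at x)" for x
    unfolding tendsto_iff
  proof (intro allI impI)
    fix e :: real assume "e > 0"
    then obtain i where i: "(1/2::real) ^ i < e"
      using real_arch_pow_inv[of e "1/2"] by auto
    \<comment> \<open>The sets \<open>V i\<close> need not be symmetric; with both differences in
      \<open>V i\<close>, \<open>step\<close> bounds \<open>g z - g x\<close> from above and
      below.\<close>
    have "((\<lambda>z. z - x) \<longlongrightarrow> x - x) (at x)" "((\<lambda>z. x - z) \<longlongrightarrow> x - x) (at x)"
      by (intro tendsto_intros)+
    from this[THEN topological_tendstoD, OF V(1), of i]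
    have "\<forall>\<^sub>F z in at x. z - x \<in> V i" "\<forall>\<^sub>F z in at x. x - z \<in> V i"
      using V(2) by simp_all
    then show "\<forall>\<^sub>F z in at x. dist (g z) (g x) < e"
    proof eventually_elim
      case (elim z)
      then show ?case
        using step[of "z - x" i x] step[of "x - z" i z] i by (simp add: dist_real_def abs_less_iff)
    qed
  qed
  then have "continuous_on UNIV g" by (simp add: continuous_on_def)
  then show ?thesis using ge0 le1 g0 g1 by (intro exI[of _ g]) auto
qed

lemma Urysohn_topological_ab_group_add:
  fixes U :: "'a::topological_ab_group_add set"
  assumes "open U" "y \<in> U"
  shows "\<exists>g. continuous_on UNIV g \<and> range g \<subseteq> {0..1::real} \<and> g y = 0 \<and> (\<forall>x. x \<notin> U \<longrightarrow> g x = 1)"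
proof -
  have "open ((\<lambda>x. x + y) -` U)"
    using assms by (intro open_vimage continuous_intros)
  then obtain g where g: "continuous_on UNIV g" "range g \<subseteq> {0..1::real}" "g 0 = 0"
      "\<And>x. x \<notin> (\<lambda>x. x + y) -` U \<Longrightarrow> g x = 1"
    using Urysohn_topological_ab_group_add_0[of "(\<lambda>x. x + y) -` U"] assms by auto
  have "continuous_on UNIV (\<lambda>x. g (x - y))"
    by (intro continuous_on_compose2[OF g(1)] continuous_intros) auto
  then show ?thesis using g(2-) by (intro exI[of _ "\<lambda>x. g (x - y)"]) auto
qed

subsection \<open>Exponential rates\<close>

text \<open>Passing to exponentials avoids infinite logarithms: for \<open>p = 0\<close> both sides
  hold, for \<open>p = \<infinity>\<close> both fail.\<close>

lemma elog_le_iff: "elog p \<le> ereal c \<longleftrightarrow> p \<le> ennreal (exp c)"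
proof (cases p)
  case (real r)
  show ?thesis
  proof (cases "r = 0")
    case False
    then have "r > 0" using real by simp
    then have "ln r \<le> c \<longleftrightarrow> r \<le> exp c" by (metis exp_le_cancel_iff exp_ln)
    then show ?thesis using \<open>r > 0\<close> real by (simp add: elog_def)
  qed (simp add: elog_def real)
qed (simp add: elog_def top_unique)

lemma rate_le_iff:
  assumes "n \<ge> 1"
  shows "ereal (1 / real n) * elog p \<le> ereal c \<longleftrightarrow> p \<le> ennreal (exp (real n * c))"
proof -
  have "ereal (1 / real n) * elog p \<le> ereal c \<longleftrightarrow> elog p \<le> ereal (real n * c)"
    using assms by (cases "elog p") (auto simp: field_simps)
  then show ?thesis by (simp add: elog_le_iff)
qed

lemma less_rate_iff:
  assumes "n \<ge> 1"
  shows "ereal c < ereal (1 / real n) * elog p \<longleftrightarrow> ennreal (exp (real n * c)) < p"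
  using rate_le_iff[OF assms, of p c] by (simp add: not_le[symmetric])

text \<open>The margin between \<open>c'\<close> and \<open>c\<close> absorbs constant factors, so
  that the property passes to finite sums.\<close>

definition exp_below :: "(nat \<Rightarrow> ennreal) \<Rightarrow> real \<Rightarrow> bool" where
  "exp_below a c \<longleftrightarrow> (\<exists>c'<c. \<forall>\<^sub>F n in sequentially. a n \<le> ennreal (exp (real n * c')))"

lemma exp_below_iff_limsup:
  "exp_below a c \<longleftrightarrow> limsup (\<lambda>n. ereal (1 / real n) * elog (a n)) < ereal c" (is "_ \<longleftrightarrow> limsup ?r < _")
proof
  assume "exp_below a c"
  then obtain c' where c': "c' < c" "\<forall>\<^sub>F n in sequentially. a n \<le> ennreal (exp (real n * c'))"
    by (auto simp: exp_below_def)
  from c'(2) eventually_ge_at_top[of 1]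
  have "\<forall>\<^sub>F n in sequentially. ?r n \<le> ereal c'"
    by eventually_elim (simp only: rate_le_iff)
  then have "limsup ?r \<le> ereal c'" by (rule Limsup_bounded)
  also have "\<dots> < ereal c" using c'(1) by simp
  finally show "limsup ?r < ereal c" .
next
  assume "limsup ?r < ereal c"
  then obtain c' where c': "limsup ?r < ereal c'" "ereal c' < ereal c"
    using ereal_dense2 by blast
  from Limsup_lessD[OF c'(1)] eventually_ge_at_top[of 1]
  have "\<forall>\<^sub>F n in sequentially. a n \<le> ennreal (exp (real n * c'))"
    by eventually_elim (use rate_le_iff less_imp_le in blast)
  then show "exp_below a c" using c'(2) by (auto simp: exp_below_def)
qed

lemma exp_below_mono:
  assumes "exp_below b c" "\<forall>\<^sub>F n in sequentially. a n \<le> b n" "c \<le> d"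
  shows "exp_below a d"
proof -
  obtain c' where c': "c' < c" "\<forall>\<^sub>F n in sequentially. b n \<le> ennreal (exp (real n * c'))"
    using assms(1) by (auto simp: exp_below_def)
  from c'(2) assms(2) have "\<forall>\<^sub>F n in sequentially. a n \<le> ennreal (exp (real n * c'))"
    by eventually_elim auto
  then show ?thesis using c'(1) assms(3) unfolding exp_below_def by (meson less_le_trans)
qed

lemma exp_below_0: "exp_below (\<lambda>_. 0) c"
  unfolding exp_below_def by (intro exI[of _ "c - 1"]) simp

lemma eventually_two_exp_less:
  assumes "c < d"
  shows "\<forall>\<^sub>F n in sequentially. exp (real n * c) + exp (real n * c) < exp (real n * d)"
proof -
  obtain k where k: "ln 2 < real k * (d - c)"
    using assms reals_Archimedean3[of "d - c"] by auto
  show ?thesis using eventually_ge_at_top[of k]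
  proof eventually_elim
    case (elim n)
    have "real k * (d - c) \<le> real n * (d - c)"
      using assms elim by (intro mult_right_mono) auto
    then have "ln 2 + real n * c < real n * d" using k by (simp add: algebra_simps)
    then have "exp (ln 2 + real n * c) < exp (real n * d)" by simp
    then show ?case by (simp add: exp_add)
  qed
qed

lemma exp_below_add:
  assumes "exp_below a c" "exp_below b c"
  shows "exp_below (\<lambda>n. a n + b n) c"
proof -
  obtain c1 c2 where c: "c1 < c" "\<forall>\<^sub>F n in sequentially. a n \<le> ennreal (exp (real n * c1))"
     "c2 < c" "\<forall>\<^sub>F n in sequentially. b n \<le> ennreal (exp (real n * c2))"
    using assms by (auto simp: exp_below_def)
  define c' where "c' = max c1 c2"
  obtain d where d: "c' < d" "d < c" using c(1,3) dense[of c' c] by (auto simp: c'_def)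
  have "\<forall>\<^sub>F n in sequentially. a n + b n \<le> ennreal (exp (real n * d))"
    using c(2,4) eventually_two_exp_less[OF d(1)]
  proof eventually_elim
    case (elim n)
    have "exp (real n * c1) \<le> exp (real n * c')" "exp (real n * c2) \<le> exp (real n * c')"
      by (auto simp: c'_def intro!: mult_left_mono)
    then have "a n \<le> ennreal (exp (real n * c'))" "b n \<le> ennreal (exp (real n * c'))"
      using elim by (meson ennreal_leI order_trans)+
    then have "a n + b n \<le> ennreal (exp (real n * c') + exp (real n * c'))"
      by (simp only: ennreal_plus exp_ge_zero add_mono)
    also have "\<dots> \<le> ennreal (exp (real n * d))"
      using elim(3) by (intro ennreal_leI) simp
    finally show ?case .
  qed
  then show ?thesis using d(2) by (auto simp: exp_below_def)
qed

lemma exp_below_exp_mult: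
  assumes "exp_below a (c - t)"
  shows "exp_below (\<lambda>n. ennreal (exp (real n * t)) * a n) c"
proof -
  obtain c' where c': "c' < c - t" "\<forall>\<^sub>F n in sequentially. a n \<le> ennreal (exp (real n * c'))"
    using assms by (auto simp: exp_below_def)
  from c'(2) have "\<forall>\<^sub>F n in sequentially.
      ennreal (exp (real n * t)) * a n \<le> ennreal (exp (real n * (c' + t)))"
  proof eventually_elim
    case (elim n)
    then have "ennreal (exp (real n * t)) * a n \<le> ennreal (exp (real n * t)) * ennreal (exp (real n * c'))"
      by (intro mult_left_mono) auto
    also have "\<dots> = ennreal (exp (real n * (c' + t)))"
      by (simp add: ennreal_mult'[symmetric] exp_add[symmetric] algebra_simps)
    finally show ?case .
  qed
  then show ?thesis using c'(1) by (auto simp: exp_below_def intro!: exI[of _ "c' + t"])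
qed

lemma exp_below_if_tendsto:
  assumes "(\<lambda>n. ereal (1 / real n) * elog (a n)) \<longlonglongrightarrow> ereal L" "L < c"
  shows "exp_below a c"
  using assms by (simp add: exp_below_iff_limsup lim_imp_Limsup)

lemma eventually_exp_less_if_tendsto:
  assumes "(\<lambda>n. ereal (1 / real n) * elog (a n)) \<longlonglongrightarrow> ereal L" "c < L"
  shows "\<forall>\<^sub>F n in sequentially. ennreal (exp (real n * c)) < a n"
proof -
  have "\<forall>\<^sub>F n in sequentially. ereal c < ereal (1 / real n) * elog (a n)"
    using assms by (intro order_tendstoD(1)) auto
  with eventually_ge_at_top[of 1] show ?thesis
    by eventually_elim (simp only: less_rate_iff)
qed

text \<open>If \<open>a n\<close> were too small, \<open>a n + b n\<close> would be at most twice an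
  exponential of rate below \<open>L\<close>, too little for \<open>t n\<close>. This turns a
  negligible complement into a lower bound.\<close>

lemma eventually_exp_less_dominant:
  assumes "(\<lambda>n. ereal (1 / real n) * elog (t n)) \<longlonglongrightarrow> ereal L"
    and "\<forall>\<^sub>F n in sequentially. t n \<le> a n + b n" "exp_below b L" "c < L"
  shows "\<forall>\<^sub>F n in sequentially. ennreal (exp (real n * c)) < a n"
proof -
  obtain c' where c': "c' < L" "\<forall>\<^sub>F n in sequentially. b n \<le> ennreal (exp (real n * c'))"
    using assms(3) by (auto simp: exp_below_def)
  \<comment> \<open>\<open>m\<close> dominates both rates, and the gap from \<open>m\<close> to some
    \<open>d < L\<close> absorbs the factor \<open>2\<close>.\<close>
  define m where "m = max c c'"
  obtain d where d: "m < d" "d < L"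
    using dense[of m L] assms(4) c'(1) by (auto simp: m_def)
  from eventually_exp_less_if_tendsto[OF assms(1) d(2)] assms(2) c'(2) eventually_two_exp_less[OF d(1)]
  show ?thesis
  proof eventually_elim
    case (elim n)
    show ?case
    proof (rule ccontr)
      assume "\<not> ennreal (exp (real n * c)) < a n"
      then have "a n \<le> ennreal (exp (real n * c))" by simp
      also have "\<dots> \<le> ennreal (exp (real n * m))"
        by (auto simp: m_def intro!: ennreal_leI mult_left_mono)
      finally have a: "a n \<le> ennreal (exp (real n * m))" .
      have "ennreal (exp (real n * c')) \<le> ennreal (exp (real n * m))"
        by (auto simp: m_def intro!: ennreal_leI mult_left_mono)
      with elim(3) have "b n \<le> ennreal (exp (real n * m))" by (rule order_trans)
      with a have "t n \<le> ennreal (exp (real n * m)) + ennreal (exp (real n * m))"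
        using elim(2) by (meson add_mono order_trans)
      also have "\<dots> = ennreal (exp (real n * m) + exp (real n * m))"
        by (simp only: ennreal_plus exp_ge_zero)
      also have "\<dots> \<le> ennreal (exp (real n * d))"
        using elim(4) by (intro ennreal_leI) simp
      finally show False using elim(1) by simp
    qed
  qed
qed

subsection \<open>Topological preliminaries\<close>

abbreviation pair_topology :: "('a::hausdorff_tvs \<times> 'b::hausdorff_tvs) topology" where
  "pair_topology \<equiv> prod_topology weak_topology euclidean"

lemma openin_weak_vimage:
  assumes "f \<in> topological_dual" "open U"
  shows "openin weak_topology (f -` U)"
  unfolding weak_topology_def using assms by (intro topology_generated_by_Basis) blast

lemma continuous_map_weak_topology:
  assumes "f \<in> topological_dual"
  shows "continuous_map weak_topology euclideanreal f"
  using openin_weak_vimage[OF assms] by (simp add: continuous_map vimage_def)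

lemma continuous_map_pair_topology:
  assumes "f \<in> topological_dual" "\<phi> \<in> bcontfun"
  shows "continuous_map pair_topology euclideanreal (\<lambda>p. f (fst p) + \<phi> (snd p))"
proof (rule continuous_map_add)
  show "continuous_map pair_topology euclideanreal (\<lambda>p. f (fst p))"
    using continuous_map_compose[OF continuous_map_fst continuous_map_weak_topology[OF assms(1)]]
    by (simp add: o_def)
  have "continuous_map euclidean euclideanreal \<phi>"
    using assms(2) by (simp add: bcontfun_def)
  from continuous_map_compose[OF continuous_map_snd this]
  show "continuous_map pair_topology euclideanreal (\<lambda>p. \<phi> (snd p))"
    by (simp add: o_def)
qed

lemma zero_in_topological_dual: "(\<lambda>_. 0) \<in> topological_dual"
  by (auto simp: topological_dual_def intro!: linearI)

lemma zero_in_bcontfun: "(\<lambda>_. 0::real) \<in> bcontfun"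
  by (simp add: bcontfun_def)

text \<open>If the dual does not separate points, then \<open>GX_star\<close> is invariant under some nonzero translation,
  and there are no exposed points.\<close>

lemma Hausdorff_weak_topology_if_exposed:
  fixes D :: "('a::hausdorff_tvs \<Rightarrow> real) set"
  assumes "x \<in> exposed_set D G" and D: "D \<subseteq> topological_dual"
  shows "Hausdorff_space (weak_topology :: 'a topology)"
  unfolding Hausdorff_space_def
proof (intro allI impI)
  fix p q :: 'a
  assume pq: "p \<in> topspace weak_topology \<and> q \<in> topspace weak_topology \<and> p \<noteq> q"
  have "\<exists>g\<in>topological_dual. g p \<noteq> g q"
  proof (rule ccontr)
    assume "\<not> (\<exists>g\<in>topological_dual. g p \<noteq> g q)"
    then have eq: "g (x + (p - q)) = g x" if "g \<in> topological_dual" for g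
      using that by (auto simp: topological_dual_def linear_add linear_diff)
    obtain f where f: "exposing_hyperplane (GX_star D G) x f"
      using assms(1) by (auto simp: exposed_set_def)
    have "GX_star D G (x + (p - q)) = GX_star D G x"
      unfolding GX_star_def using eq D by (intro SUP_cong) auto
    moreover have "x + (p - q) \<noteq> x" using pq by simp
    ultimately show False
      using f eq[of f] unfolding exposing_hyperplane_def by (metis less_irrefl)
  qed
  then obtain g where g: "g \<in> topological_dual" "g p \<noteq> g q" by blast
  obtain U V where "open U" "open V" "g p \<in> U" "g q \<in> V" "U \<inter> V = {}"
    using hausdorff[OF g(2)] by blast
  then show "\<exists>U V. openin weak_topology U \<and> openin weak_topology V \<and> p \<in> U \<and> q \<in> V \<and> disjnt U V"
    using openin_weak_vimage[OF g(1)]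
    by (intro exI[of _ "g -` U"] exI[of _ "g -` V"]) (auto simp: disjnt_def)
qed

lemma random_element_openin:
  assumes "random_element M T Z" "openin T W"
  shows "{\<omega> \<in> space M. Z \<omega> \<in> W} \<in> sets M"
proof -
  have "W \<in> sets (borel_of T)"
    unfolding borel_of_def using assms(2)
    by (subst sets_measure_of) (auto dest: openin_subset)
  from measurable_sets[OF assms(1)[unfolded random_element_def] this] show ?thesis
    by (simp add: vimage_def Int_def conj_commute)
qed

lemma random_element_continuous_map:
  assumes "random_element M T Z" "continuous_map T euclideanreal g" "topspace T = UNIV"
  shows "(\<lambda>\<omega>. g (Z \<omega>)) \<in> borel_measurable M"
proof (rule borel_measurableI)
  fix S :: "real set" assume "open S"
  then have "openin T {z. g z \<in> S}"
    using assms(2,3) by (simp add: continuous_map)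
  from random_element_openin[OF assms(1) this]
  show "(\<lambda>\<omega>. g (Z \<omega>)) -` S \<inter> space M \<in> sets M"
    by (simp add: vimage_def Int_def conj_commute)
qed

text \<open>Both suprema run over nonempty families of reals, so neither is
  \<open>-\<infinity>\<close> and addition commutes with them. The rate becomes one supremum over
  pairs of tilts, the form used for Chernoff bounds and for closed sublevel sets.\<close>

lemma GX_star_plus_IY_le_iff:
  assumes "D \<noteq> {}"
  shows "GX_star D G x + IY J y \<le> ereal a \<longleftrightarrow>
    (\<forall>h\<in>D. \<forall>\<psi>\<in>bcontfun. h x + \<psi> y - (G h + J \<psi>) \<le> a)"
proof -
  have "(\<lambda>_. 0::real) \<in> bcontfun" by (rule zero_in_bcontfun)
  then have "IY J y \<ge> ereal (0 - J (\<lambda>_. 0))"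
    unfolding IY_def by (rule SUP_upper2) simp
  then have "IY J y \<noteq> -\<infinity>" by auto
  then have "GX_star D G x + IY J y = (SUP h\<in>D. ereal (h x - G h) + IY J y)"
    unfolding GX_star_def using assms by (subst SUP_ereal_add_left) auto
  also have "\<dots> = (SUP h\<in>D. SUP \<psi>\<in>bcontfun. ereal (h x - G h) + ereal (\<psi> y - J \<psi>))"
    unfolding IY_def using zero_in_bcontfun by (subst SUP_ereal_add_right) auto
  finally show ?thesis
    by (simp add: SUP_le_iff algebra_simps)
qed

subsection \<open>Exponentially tilted laws\<close>

locale asymptotically_independent_pair = prob_space M
  for M :: "'w measure" +
  fixes X :: "nat \<Rightarrow> 'w \<Rightarrow> 'a::hausdorff_tvs"
    and Y :: "nat \<Rightarrow> 'w \<Rightarrow> 'b::hausdorff_tvs"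
    and D :: "('a \<Rightarrow> real) set"
    and G :: "('a \<Rightarrow> real) \<Rightarrow> real"
    and J :: "('b \<Rightarrow> real) \<Rightarrow> real"
  assumes random_pair: "\<And>n. n \<ge> 1 \<Longrightarrow> random_element M pair_topology (\<lambda>\<omega>. (X n \<omega>, Y n \<omega>))"
    and tight_X: "exponentially_tight M weak_topology X"
    and tight_Y: "exponentially_tight M euclidean Y"
    and D_dual: "D \<subseteq> topological_dual"
    and log_moment: "\<And>f \<phi>. f \<in> D \<Longrightarrow> \<phi> \<in> bcontfun \<Longrightarrow>
           (\<lambda>n. ereal (1 / real n) *
              elog (\<integral>\<^sup>+ \<omega>. ennreal (exp (real n * f (X n \<omega>) + real n * \<phi> (Y n \<omega>))) \<partial>M))
           \<longlonglongrightarrow> ereal (G f + J \<phi>)"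
begin

definition weight :: "('a \<Rightarrow> real) \<Rightarrow> ('b \<Rightarrow> real) \<Rightarrow> nat \<Rightarrow> 'w \<Rightarrow> ennreal" where
  "weight f \<phi> n \<omega> = ennreal (exp (real n * f (X n \<omega>) + real n * \<phi> (Y n \<omega>)))"

text \<open>The unnormalised tilted law: \<open>A = UNIV\<close> gives the moment in
  \<open>log_moment\<close>, and zero tilts give the probability of \<open>A\<close>.\<close>

definition mass :: "('a \<Rightarrow> real) \<Rightarrow> ('b \<Rightarrow> real) \<Rightarrow> ('a \<times> 'b) set \<Rightarrow> nat \<Rightarrow> ennreal" where
  "mass f \<phi> A n = (\<integral>\<^sup>+ \<omega>. weight f \<phi> n \<omega> * indicator A (X n \<omega>, Y n \<omega>) \<partial>M)"

text \<open>Complements of compact sets need not be Borel when the weak topology is not Hausdorff,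
  so measurability is recorded for the events themselves.\<close>

definition observable :: "('a \<times> 'b) set \<Rightarrow> bool" where
  "observable A \<longleftrightarrow> (\<forall>n\<ge>1. {\<omega> \<in> space M. (X n \<omega>, Y n \<omega>) \<in> A} \<in> sets M)"

lemma observable_openin: "openin pair_topology W \<Longrightarrow> observable W"
  unfolding observable_def using random_element_openin[OF random_pair] by blast

lemma observable_Compl: "observable A \<Longrightarrow> observable (- A)"
  unfolding observable_def
proof (intro allI impI)
  fix n :: nat assume "\<forall>n\<ge>1. {\<omega> \<in> space M. (X n \<omega>, Y n \<omega>) \<in> A} \<in> sets M" "n \<ge> 1"
  moreover have "{\<omega> \<in> space M. (X n \<omega>, Y n \<omega>) \<in> - A} =
      space M - {\<omega> \<in> space M. (X n \<omega>, Y n \<omega>) \<in> A}" by auto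
  ultimately show "{\<omega> \<in> space M. (X n \<omega>, Y n \<omega>) \<in> - A} \<in> sets M" by auto
qed

lemma observable_Un: "observable A \<Longrightarrow> observable B \<Longrightarrow> observable (A \<union> B)"
  unfolding observable_def
proof (intro allI impI)
  fix n :: nat assume "\<forall>n\<ge>1. {\<omega> \<in> space M. (X n \<omega>, Y n \<omega>) \<in> A} \<in> sets M"
    "\<forall>n\<ge>1. {\<omega> \<in> space M. (X n \<omega>, Y n \<omega>) \<in> B} \<in> sets M" "n \<ge> 1"
  moreover have "{\<omega> \<in> space M. (X n \<omega>, Y n \<omega>) \<in> A \<union> B} =
      {\<omega> \<in> space M. (X n \<omega>, Y n \<omega>) \<in> A} \<union> {\<omega> \<in> space M. (X n \<omega>, Y n \<omega>) \<in> B}" by auto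
  ultimately show "{\<omega> \<in> space M. (X n \<omega>, Y n \<omega>) \<in> A \<union> B} \<in> sets M" by auto
qed

lemma observable_closedin:
  assumes "closedin pair_topology C"
  shows "observable C"
proof -
  have "openin pair_topology (- C)"
    using assms by (simp add: closedin_def Compl_eq_Diff_UNIV)
  from observable_Compl[OF observable_openin[OF this]] show ?thesis by simp
qed

section \<open>Elementary estimates for tilted masses\<close>

lemma mass_mono:
  assumes "A \<subseteq> B"
  shows "mass f \<phi> A n \<le> mass f \<phi> B n"
  unfolding mass_def using assms
  by (intro nn_integral_mono mult_left_mono) (auto split: split_indicator)

lemma weight_measurable:
  assumes "f \<in> topological_dual" "\<phi> \<in> bcontfun" "n \<ge> 1"
  shows "weight f \<phi> n \<in> borel_measurable M"
proof -
  have "(\<lambda>\<omega>. f (X n \<omega>) + \<phi> (Y n \<omega>)) \<in> borel_measurable M"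
    using random_element_continuous_map[OF random_pair[OF assms(3)]
        continuous_map_pair_topology[OF assms(1,2)]] by simp
  then have "(\<lambda>\<omega>. ennreal (exp (real n * (f (X n \<omega>) + \<phi> (Y n \<omega>))))) \<in> borel_measurable M"
    by measurable
  then show ?thesis by (simp add: weight_def[abs_def] distrib_left)
qed

lemma indicator_measurable:
  assumes "observable A" "n \<ge> 1"
  shows "(\<lambda>\<omega>. indicator A (X n \<omega>, Y n \<omega>) :: ennreal) \<in> borel_measurable M"
proof -
  have "{\<omega> \<in> space M. (X n \<omega>, Y n \<omega>) \<in> A} \<in> sets M"
    using assms by (simp add: observable_def)
  then have "(indicator {\<omega> \<in> space M. (X n \<omega>, Y n \<omega>) \<in> A} :: 'w \<Rightarrow> ennreal) \<in> borel_measurable M"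
    by simp
  then show ?thesis
    by (rule measurable_cong[THEN iffD1, rotated]) (auto split: split_indicator)
qed

lemma mass_Un_le:
  assumes "f \<in> topological_dual" "\<phi> \<in> bcontfun" "observable A" "observable B" "n \<ge> 1"
  shows "mass f \<phi> (A \<union> B) n \<le> mass f \<phi> A n + mass f \<phi> B n"
proof -
  note [measurable] = weight_measurable[OF assms(1,2,5)] indicator_measurable[OF assms(3,5)]
    indicator_measurable[OF assms(4,5)]
  have "mass f \<phi> (A \<union> B) n \<le> (\<integral>\<^sup>+ \<omega>. weight f \<phi> n \<omega> * indicator A (X n \<omega>, Y n \<omega>) +
      weight f \<phi> n \<omega> * indicator B (X n \<omega>, Y n \<omega>) \<partial>M)"
    unfolding mass_def by (intro nn_integral_mono) (auto split: split_indicator)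
  also have "\<dots> = mass f \<phi> A n + mass f \<phi> B n"
    unfolding mass_def by (rule nn_integral_add) measurable
  finally show ?thesis .
qed

text \<open>Change of tilt: on \<open>A\<close> the exponents differ by at most \<open>n t\<close>,
  so the weights differ by at most the factor \<open>exp (n t)\<close>.\<close>

lemma mass_tilt_le:
  assumes "f \<in> topological_dual" "\<phi> \<in> bcontfun" "n \<ge> 1" "observable A"
    and "\<And>x y. (x, y) \<in> A \<Longrightarrow> h x + \<psi> y \<le> f x + \<phi> y + t"
  shows "mass h \<psi> A n \<le> ennreal (exp (real n * t)) * mass f \<phi> A n"
proof -
  note [measurable] = weight_measurable[OF assms(1-3)] indicator_measurable[OF assms(4,3)]
  have "weight h \<psi> n \<omega> \<le> ennreal (exp (real n * t)) * weight f \<phi> n \<omega>"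
    if "(X n \<omega>, Y n \<omega>) \<in> A" for \<omega>
  proof -
    have "real n * (h (X n \<omega>) + \<psi> (Y n \<omega>)) \<le> real n * (f (X n \<omega>) + \<phi> (Y n \<omega>) + t)"
      using assms(5)[OF that] by (intro mult_left_mono) auto
    then show ?thesis
      unfolding weight_def
      by (simp add: ennreal_mult'[symmetric] exp_add[symmetric] algebra_simps)
  qed
  then have "mass h \<psi> A n \<le> (\<integral>\<^sup>+ \<omega>. ennreal (exp (real n * t)) *
      (weight f \<phi> n \<omega> * indicator A (X n \<omega>, Y n \<omega>)) \<partial>M)"
    unfolding mass_def by (intro nn_integral_mono) (auto split: split_indicator)
  also have "\<dots> = ennreal (exp (real n * t)) * mass f \<phi> A n"
    unfolding mass_def by (rule nn_integral_cmult) measurable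
  finally show ?thesis .
qed

lemma mass_0_eq_emeasure:
  assumes "observable A" "n \<ge> 1"
  shows "mass (\<lambda>_. 0) (\<lambda>_. 0) A n = emeasure M {\<omega> \<in> space M. (X n \<omega>, Y n \<omega>) \<in> A}"
proof -
  have "mass (\<lambda>_. 0) (\<lambda>_. 0) A n = (\<integral>\<^sup>+ \<omega>. indicator {\<omega> \<in> space M. (X n \<omega>, Y n \<omega>) \<in> A} \<omega> \<partial>M)"
    unfolding mass_def weight_def by (intro nn_integral_cong) (auto split: split_indicator)
  then show ?thesis using assms by (simp add: observable_def)
qed

lemma mass_UNIV_tendsto:
  assumes "f \<in> D" "\<phi> \<in> bcontfun"
  shows "(\<lambda>n. ereal (1 / real n) * elog (mass f \<phi> UNIV n)) \<longlonglongrightarrow> ereal (G f + J \<phi>)"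
  using log_moment[OF assms] by (simp add: mass_def weight_def)

section \<open>Exponential bounds for tilted masses\<close>

lemma exp_below_mass_Un:
  assumes "f \<in> topological_dual" "\<phi> \<in> bcontfun" "observable A" "observable B"
    and "exp_below (mass f \<phi> A) c" "exp_below (mass f \<phi> B) c"
  shows "exp_below (mass f \<phi> (A \<union> B)) c"
  using exp_below_add[OF assms(5,6)]
proof (rule exp_below_mono)
  show "\<forall>\<^sub>F n in sequentially. mass f \<phi> (A \<union> B) n \<le> mass f \<phi> A n + mass f \<phi> B n"
    using eventually_ge_at_top[of 1] by eventually_elim (rule mass_Un_le[OF assms(1-4)])
qed simp

lemma exp_below_mass_subset:
  assumes "exp_below (mass f \<phi> B) c" "A \<subseteq> B"
  shows "exp_below (mass f \<phi> A) c"
  using assms(1) by (rule exp_below_mono) (use mass_mono[OF assms(2)] in auto)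

text \<open>Chernoff bound: near \<open>(x, y)\<close> the mass is at most \<open>exp (n t)\<close>
  times the total mass for \<open>(h, \<psi>)\<close>, whose rate is
  \<open>G h + J \<psi>\<close>.\<close>

lemma exp_below_mass_neighbourhood:
  assumes "f \<in> topological_dual" "\<phi> \<in> bcontfun" "h \<in> D" "\<psi> \<in> bcontfun"
    and "f x + \<phi> y - (h x + \<psi> y) + (G h + J \<psi>) < c"
  shows "\<exists>W. openin pair_topology W \<and> (x, y) \<in> W \<and> exp_below (mass f \<phi> W) c"
proof -
  have h: "h \<in> topological_dual" using assms(3) D_dual by auto
  \<comment> \<open>The first inequality puts \<open>(x, y)\<close> into \<open>W\<close>; the
    second keeps the resulting rate \<open>t + G h + J \<psi>\<close> below
    \<open>c\<close>.\<close>
  obtain t where t: "f x + \<phi> y - (h x + \<psi> y) < t" "t < c - (G h + J \<psi>)"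
    using dense[of "f x + \<phi> y - (h x + \<psi> y)" "c - (G h + J \<psi>)"] assms(5) by auto
  define W where "W = {p::'a \<times> 'b. (f (fst p) + \<phi> (snd p)) - (h (fst p) + \<psi> (snd p)) \<in> {..<t}}"
  have "continuous_map pair_topology euclideanreal
      (\<lambda>p. (f (fst p) + \<phi> (snd p)) - (h (fst p) + \<psi> (snd p)))"
    by (intro continuous_map_diff continuous_map_pair_topology assms h)
  from openin_continuous_map_preimage[OF this, of "{..<t}"]
  have W: "openin pair_topology W" by (simp add: W_def)
  have "exp_below (mass h \<psi> UNIV) (c - t)"
    using mass_UNIV_tendsto[OF assms(3,4)] by (rule exp_below_if_tendsto) (use t(2) in simp)
  then have "exp_below (mass h \<psi> W) (c - t)" by (rule exp_below_mass_subset) simp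
  from exp_below_exp_mult[OF this]
  have "exp_below (mass f \<phi> W) c"
  proof (rule exp_below_mono)
    show "\<forall>\<^sub>F n in sequentially. mass f \<phi> W n \<le> ennreal (exp (real n * t)) * mass h \<psi> W n"
      using eventually_ge_at_top[of 1]
    proof eventually_elim
      case (elim n)
      show ?case
        by (rule mass_tilt_le[OF h assms(4) elim observable_openin[OF W]]) (auto simp: W_def)
    qed
  qed simp
  then show ?thesis using W t(1) by (intro exI[of _ W]) (auto simp: W_def)
qed

lemma exp_below_mass_Union:
  assumes "f \<in> topological_dual" "\<phi> \<in> bcontfun" "finite \<W>"
    and "\<And>W. W \<in> \<W> \<Longrightarrow> openin pair_topology W \<and> exp_below (mass f \<phi> W) c"
  shows "exp_below (mass f \<phi> (\<Union>\<W>)) c"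
  using assms(3,4)
proof (induction \<W>)
  case empty
  then show ?case using exp_below_0 by (simp add: mass_def)
next
  case (insert W \<W>)
  have "exp_below (mass f \<phi> (W \<union> \<Union>\<W>)) c"
    by (rule exp_below_mass_Un[OF assms(1,2)])
      (use insert in \<open>auto intro!: observable_openin openin_Union\<close>)
  then show ?case by simp
qed

text \<open>Finitely many Chernoff neighbourhoods cover the compact set \<open>C \<inter> K\<close>;
  the rest of \<open>C\<close> lies in the negligible set \<open>- K\<close>.\<close>

lemma exp_below_mass_closedin:
  assumes f: "f \<in> topological_dual" "\<phi> \<in> bcontfun" and C: "closedin pair_topology C"
    and K: "compactin pair_topology K" "observable (- K)" "exp_below (mass f \<phi> (- K)) c"
    and pointwise: "\<And>x y. (x, y) \<in> C \<Longrightarrow>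
      \<exists>h\<in>D. \<exists>\<psi>\<in>bcontfun. f x + \<phi> y - (h x + \<psi> y) + (G h + J \<psi>) < c"
  shows "exp_below (mass f \<phi> C) c"
proof -
  let ?\<U> = "{W. openin pair_topology W \<and> exp_below (mass f \<phi> W) c}"
  have "C \<inter> K \<subseteq> \<Union>?\<U>"
  proof
    fix p assume p: "p \<in> C \<inter> K"
    obtain x y where xy: "p = (x, y)" by (cases p)
    obtain h \<psi> where "h \<in> D" "\<psi> \<in> bcontfun" "f x + \<phi> y - (h x + \<psi> y) + (G h + J \<psi>) < c"
      using pointwise p xy by blast
    from exp_below_mass_neighbourhood[OF f this] show "p \<in> \<Union>?\<U>"
      using xy by blast
  qed
  with compactinD[OF closed_Int_compactin[OF C K(1)], of ?\<U>]
  obtain \<W> where \<W>: "finite \<W>" "\<W> \<subseteq> ?\<U>" "C \<inter> K \<subseteq> \<Union>\<W>"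
    by auto
  have "exp_below (mass f \<phi> (\<Union>\<W> \<union> - K)) c"
    by (rule exp_below_mass_Un[OF f])
      (use \<W> K in \<open>auto intro!: observable_openin openin_Union exp_below_mass_Union[OF f]\<close>)
  then show ?thesis by (rule exp_below_mass_subset) (use \<W>(3) in auto)
qed

text \<open>The complement of \<open>K \<times> L\<close> is the union of two strips, each
  controlled by the tightness of one component at level \<open>- c\<close>.\<close>

lemma compact_tail:
  "\<exists>K L. compactin weak_topology K \<and> compactin euclidean L \<and> observable (- (K \<times> L)) \<and>
    exp_below (mass (\<lambda>_. 0) (\<lambda>_. 0) (- (K \<times> L))) c"
proof -
  obtain K where K: "compactin weak_topology K"
      "\<forall>n\<ge>1. {\<omega> \<in> space M. X n \<omega> \<in> topspace weak_topology - K} \<in> sets M"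
      "limsup (log_prob_rate M X (topspace weak_topology - K)) < - ereal (- c)"
    using tight_X unfolding exponentially_tight_def by blast
  obtain L where L: "compactin euclidean L"
      "\<forall>n\<ge>1. {\<omega> \<in> space M. Y n \<omega> \<in> topspace euclidean - L} \<in> sets M"
      "limsup (log_prob_rate M Y (topspace euclidean - L)) < - ereal (- c)"
    using tight_Y unfolding exponentially_tight_def by blast
  have obs: "observable ((- K) \<times> UNIV)" "observable (UNIV \<times> (- L))"
    using K(2) L(2) by (auto simp: observable_def)
  have "exp_below (\<lambda>n. emeasure M {\<omega> \<in> space M. X n \<omega> \<in> - K}) c"
    "exp_below (\<lambda>n. emeasure M {\<omega> \<in> space M. Y n \<omega> \<in> - L}) c"
    using K(3) L(3) by (simp_all add: exp_below_iff_limsup Compl_eq_Diff_UNIV)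
  moreover have
    "\<forall>\<^sub>F n in sequentially. mass (\<lambda>_. 0) (\<lambda>_. 0) ((- K) \<times> UNIV) n \<le>
      emeasure M {\<omega> \<in> space M. X n \<omega> \<in> - K}"
    "\<forall>\<^sub>F n in sequentially. mass (\<lambda>_. 0) (\<lambda>_. 0) (UNIV \<times> (- L)) n \<le>
      emeasure M {\<omega> \<in> space M. Y n \<omega> \<in> - L}"
    by (auto intro!: eventually_sequentiallyI[of 1] simp: mass_0_eq_emeasure obs)
  ultimately have "exp_below (mass (\<lambda>_. 0) (\<lambda>_. 0) ((- K) \<times> UNIV)) c"
    "exp_below (mass (\<lambda>_. 0) (\<lambda>_. 0) (UNIV \<times> (- L))) c"
    by (blast intro: exp_below_mono)+
  then have "exp_below (mass (\<lambda>_. 0) (\<lambda>_. 0) ((- K) \<times> UNIV \<union> UNIV \<times> (- L))) c"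
    by (intro exp_below_mass_Un zero_in_topological_dual zero_in_bcontfun obs)
  moreover have "(- K) \<times> UNIV \<union> UNIV \<times> (- L) = - (K \<times> L)" by auto
  ultimately have "exp_below (mass (\<lambda>_. 0) (\<lambda>_. 0) (- (K \<times> L))) c" "observable (- (K \<times> L))"
    using observable_Un[OF obs] by simp_all
  then show ?thesis using K(1) L(1) by blast
qed

text \<open>On \<open>{f \<le> R}\<close> the weight is at most \<open>exp (n (R + sup \<phi>))\<close>; on \<open>{f > R}\<close> it is at most
  \<open>exp (- n (\<gamma> - 1) R)\<close> times the weight of \<open>(\<gamma>f, \<phi>)\<close>.\<close>

lemma compact_tail_tilted:
  assumes f: "f \<in> D" "\<phi> \<in> bcontfun" and \<gamma>: "\<gamma> > 1" "(\<lambda>z. \<gamma> * f z) \<in> D"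
  shows "\<exists>K. compactin pair_topology K \<and> observable (- K) \<and> exp_below (mass f \<phi> (- K)) c"
proof -
  let ?g = "\<lambda>z. \<gamma> * f z"
  have dual: "f \<in> topological_dual" "?g \<in> topological_dual" using f \<gamma> D_dual by auto
  obtain B where B: "\<And>y. \<phi> y \<le> B"
    using f(2) unfolding bcontfun_def bounded_iff by (auto simp: abs_le_iff)
  \<comment> \<open>On \<open>{f > R}\<close> the rate is at most
    \<open>G ?g + J \<phi> - R * (\<gamma> - 1)\<close>, which is now below
    \<open>c\<close>.\<close>
  obtain R where R: "(G ?g + J \<phi>) - c < R * (\<gamma> - 1)"
    using \<gamma>(1) reals_Archimedean3[of "\<gamma> - 1"] by (metis diff_gt_0_iff_gt)
  \<comment> \<open>The compact sets are chosen after \<open>R\<close>, with a tail small enough to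
    compensate weights up to \<open>exp (n (R + B))\<close>.\<close>
  obtain K L where KL: "compactin weak_topology K" "compactin euclidean L"
      "observable (- (K \<times> L))" "exp_below (mass (\<lambda>_. 0) (\<lambda>_. 0) (- (K \<times> L))) (c - (R + B))"
    using compact_tail by blast
  \<comment> \<open>The summand \<open>0\<close> is the zero function on the second component,
    matching \<open>continuous_map_pair_topology\<close>.\<close>
  define S where "S = {p :: 'a \<times> 'b. f (fst p) + 0 \<in> {R<..}}"
  have "openin pair_topology S"
    using openin_continuous_map_preimage[OF
        continuous_map_pair_topology[OF dual(1) zero_in_bcontfun], of "{R<..}"]
    by (simp add: S_def)
  then have S: "observable S" by (rule observable_openin)
  have KS: "observable (- (K \<times> L) - S)"
    using observable_Compl[OF observable_Un[OF observable_Compl[OF KL(3)] S]]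
    by (simp add: Diff_eq)
  have "exp_below (mass (\<lambda>_. 0) (\<lambda>_. 0) (- (K \<times> L) - S)) (c - (R + B))"
    using KL(4) by (rule exp_below_mass_subset) auto
  from exp_below_exp_mult[OF this] have 1: "exp_below (mass f \<phi> (- (K \<times> L) - S)) c"
  proof (rule exp_below_mono)
    show "\<forall>\<^sub>F n in sequentially. mass f \<phi> (- (K \<times> L) - S) n \<le>
        ennreal (exp (real n * (R + B))) * mass (\<lambda>_. 0) (\<lambda>_. 0) (- (K \<times> L) - S) n"
      using eventually_ge_at_top[of 1]
    proof eventually_elim
      case (elim n)
      show ?case
        by (rule mass_tilt_le[OF zero_in_topological_dual zero_in_bcontfun elim KS])
          (auto simp: S_def not_less intro: add_mono B)
    qed
  qed simp
  have "exp_below (mass ?g \<phi> UNIV) (c - (- (R * (\<gamma> - 1))))"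
    using mass_UNIV_tendsto[OF \<gamma>(2) f(2)] by (rule exp_below_if_tendsto) (use R in simp)
  then have "exp_below (mass ?g \<phi> S) (c - (- (R * (\<gamma> - 1))))"
    by (rule exp_below_mass_subset) simp
  from exp_below_exp_mult[OF this] have 2: "exp_below (mass f \<phi> S) c"
  proof (rule exp_below_mono)
    show "\<forall>\<^sub>F n in sequentially. mass f \<phi> S n \<le>
        ennreal (exp (real n * (- (R * (\<gamma> - 1))))) * mass ?g \<phi> S n"
      using eventually_ge_at_top[of 1]
    proof eventually_elim
      case (elim n)
      show ?case
      proof (rule mass_tilt_le[OF dual(2) f(2) elim S])
        fix x y assume "(x, y) \<in> S"
        then have "R * (\<gamma> - 1) \<le> f x * (\<gamma> - 1)"
          using \<gamma>(1) by (intro mult_right_mono) (auto simp: S_def)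
        then show "f x + \<phi> y \<le> \<gamma> * f x + \<phi> y + - (R * (\<gamma> - 1))"
          by (simp add: algebra_simps)
      qed
    qed
  qed simp
  have "exp_below (mass f \<phi> ((- (K \<times> L) - S) \<union> S)) c"
    by (rule exp_below_mass_Un[OF dual(1) f(2) KS S 1 2])
  then have "exp_below (mass f \<phi> (- (K \<times> L))) c" by (rule exp_below_mass_subset) auto
  moreover have "compactin pair_topology (K \<times> L)"
    using KL(1,2) by (simp add: compactin_Times)
  ultimately show ?thesis using KL(3) by blast
qed

subsection \<open>The large deviation principle\<close>

abbreviation rate :: "'a \<times> 'b \<Rightarrow> ereal" where
  "rate \<equiv> \<lambda>(x, y). GX_star D G x + IY J y"

text \<open>If the infimum over \<open>C\<close> exceeds \<open>- c\<close>, each point of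
  \<open>C\<close> has a pair \<open>(h, \<psi>)\<close> witnessing this, which is the pointwise
  condition of \<open>exp_below_mass_closedin\<close> for zero tilts.\<close>

lemma upper_bound:
  assumes "D \<noteq> {}" and C: "closedin pair_topology C"
  shows "limsup (log_prob_rate M (\<lambda>n \<omega>. (X n \<omega>, Y n \<omega>)) C) \<le> - (INF z\<in>C. rate z)"
proof (rule dense_ge)
  fix e :: ereal
  assume "- (INF z\<in>C. rate z) < e"
  then obtain c where c: "- (INF z\<in>C. rate z) < ereal c" "ereal c < e"
    using ereal_dense2 by blast
  obtain K L where KL: "compactin weak_topology K" "compactin euclidean L"
    "observable (- (K \<times> L))" "exp_below (mass (\<lambda>_. 0) (\<lambda>_. 0) (- (K \<times> L))) c"
    using compact_tail by blast
  have "exp_below (mass (\<lambda>_. 0) (\<lambda>_. 0) C) c"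
  proof (rule exp_below_mass_closedin[OF zero_in_topological_dual zero_in_bcontfun C _ KL(3,4)])
    show "compactin pair_topology (K \<times> L)"
      using KL(1,2) by (simp add: compactin_Times)
    fix x y assume "(x, y) \<in> C"
    then have "(INF z\<in>C. rate z) \<le> rate (x, y)" by (rule INF_lower)
    moreover have "ereal (- c) < (INF z\<in>C. rate z)"
      using c(1) by (simp add: ereal_uminus_less_reorder)
    ultimately have "\<not> GX_star D G x + IY J y \<le> ereal (- c)" by (simp add: not_le)
    then obtain h \<psi> where "h \<in> D" "\<psi> \<in> bcontfun" "- c < h x + \<psi> y - (G h + J \<psi>)"
      unfolding GX_star_plus_IY_le_iff[OF assms(1)] by (auto simp: not_le)
    then show "\<exists>h\<in>D. \<exists>\<psi>\<in>bcontfun. 0 + 0 - (h x + \<psi> y) + (G h + J \<psi>) < c"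
      by (intro bexI[of _ h] bexI[of _ \<psi>]) auto
  qed
  then have "exp_below (\<lambda>n. emeasure M {\<omega> \<in> space M. (X n \<omega>, Y n \<omega>) \<in> C}) c"
    by (rule exp_below_mono)
      (auto intro!: eventually_sequentiallyI[of 1]
        simp: mass_0_eq_emeasure[OF observable_closedin[OF C]])
  then show "limsup (log_prob_rate M (\<lambda>n \<omega>. (X n \<omega>, Y n \<omega>)) C) \<le> e"
    unfolding exp_below_iff_limsup using c(2) by (meson less_imp_le order_trans)
qed

text \<open>Tilt by \<open>(f, \<phi>)\<close>, where \<open>f\<close> exposes \<open>x\<close> and \<open>\<phi>\<close> has a high peak at \<open>y\<close>: outside of a
  neighbourhood of \<open>(x, y)\<close> the tilted mass is exponentially negligible.\<close>

lemma lower_bound_exposed: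
  assumes x: "x \<in> exposed_set D G" and U: "openin weak_topology U" "x \<in> U"
    and V: "open V" "y \<in> V"
    and b: "IY J y = ereal b" and c: "GX_star D G x < ereal (- c - b)"
  shows "\<forall>\<^sub>F n in sequentially. ennreal (exp (real n * c)) < mass (\<lambda>_. 0) (\<lambda>_. 0) (U \<times> V) n"
proof -
  obtain f \<gamma> where f: "f \<in> D" "exposing_hyperplane (GX_star D G) x f"
    and \<gamma>: "\<gamma> > 1" "(\<lambda>z. \<gamma> * f z) \<in> D"
    using x by (auto simp: exposed_set_def)
  have fd: "f \<in> topological_dual" using f(1) D_dual by auto
  obtain g where g: "continuous_on UNIV g" "range g \<subseteq> {0..1::real}" "g y = 0"
      "\<And>z. z \<notin> V \<Longrightarrow> g z = 1"
    using Urysohn_topological_ab_group_add[OF V] by blast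
  \<comment> \<open>Away from \<open>V\<close>, \<open>\<phi>\<close> equals \<open>- m\<close>;
    this height gives \<open>- m + J 0 < - b \<le> J \<phi>\<close>. The maximum with
    \<open>0\<close> makes \<open>\<phi>\<close> nonpositive.\<close>
  define m where "m = max 0 (J (\<lambda>_. 0) + b + 1)"
  define \<phi> where "\<phi> z = - m * g z" for z
  have m: "m \<ge> 0" "J (\<lambda>_. 0) + b < m" by (auto simp: m_def)
  have \<phi>le: "\<phi> z \<le> 0" and \<phi>ge: "- m \<le> \<phi> z" for z
  proof -
    have "g z \<in> {0..1}" using g(2) by blast
    then show "\<phi> z \<le> 0" "- m \<le> \<phi> z"
      using m(1) by (auto simp: \<phi>_def intro: mult_left_le)
  qed
  have \<phi>: "\<phi> \<in> bcontfun"
  proof -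
    have "continuous_on UNIV \<phi>"
      unfolding \<phi>_def by (intro continuous_intros g(1))
    moreover have "\<bar>\<phi> z\<bar> \<le> m" for z using \<phi>le[of z] \<phi>ge[of z] by simp
    ultimately show ?thesis unfolding bcontfun_def bounded_iff by auto
  qed
  \<comment> \<open>As \<open>\<phi> y = 0\<close>, the definition of \<open>IY\<close> as a
    supremum bounds \<open>J \<phi>\<close> from below.\<close>
  have "ereal (\<phi> y - J \<phi>) \<le> IY J y"
    unfolding IY_def using \<phi> by (rule SUP_upper)
  then have J: "- b \<le> J \<phi>" using b g(3) by (simp add: \<phi>_def)
  have GX: "ereal (f x - G f) \<le> GX_star D G x"
    unfolding GX_star_def using f(1) by (rule SUP_upper)
  then have "ereal (f x - G f) < ereal (- c - b)" using c by (rule le_less_trans)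
  then have s: "c < G f - f x + J \<phi>" using J by simp
  \<comment> \<open>Half of the available gap, so that \<open>c + (f x + e)\<close> is still below
    the total rate \<open>G f + J \<phi>\<close>.\<close>
  define e where "e = (G f - f x + J \<phi> - c) / 2"
  have e: "e > 0" using s by (simp add: e_def)
  \<comment> \<open>The bound on \<open>f\<close> limits the cost of undoing the tilt on
    \<open>U' \<times> V\<close> to \<open>exp (n (f x + e))\<close>.\<close>
  define U' where "U' = U \<inter> f -` {..< f x + e}"
  have U': "openin weak_topology U'" "x \<in> U'"
    using U e openin_weak_vimage[OF fd, of "{..<f x + e}"] by (auto simp: U'_def)
  have A: "openin pair_topology (U' \<times> V)"
    using U'(1) V(1) by (simp add: openin_prod_Times_iff)
  have cl: "closedin pair_topology (- (U' \<times> V))"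
    using A by (simp add: closedin_def Compl_eq_Diff_UNIV double_diff)
  obtain K where K: "compactin pair_topology K" "observable (- K)"
      "exp_below (mass f \<phi> (- K)) (G f + J \<phi>)"
    using compact_tail_tilted[OF f(1) \<phi> \<gamma>] by blast
  have small: "exp_below (mass f \<phi> (- (U' \<times> V))) (G f + J \<phi>)"
  proof (rule exp_below_mass_closedin[OF fd \<phi> cl K])
    fix z v assume "(z, v) \<in> - (U' \<times> V)"
    \<comment> \<open>If \<open>v \<notin> V\<close>, the peak is removed by comparing with
      \<open>(f, 0)\<close>; if \<open>z \<noteq> x\<close>, the exposing property supplies a better
      \<open>h\<close>, with \<open>\<phi>\<close> kept.\<close>
    then consider "v \<notin> V" | "z \<noteq> x" using U'(2) by auto
    then show "\<exists>h\<in>D. \<exists>\<psi>\<in>bcontfun. f z + \<phi> v - (h z + \<psi> v) + (G h + J \<psi>) < G f + J \<phi>"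
    proof cases
      case 1
      then have "\<phi> v = - m" by (simp add: \<phi>_def g(4))
      then show ?thesis using f(1) m(2) J zero_in_bcontfun
        by (intro bexI[of _ f] bexI[of _ "\<lambda>_. 0"]) auto
    next
      case 2
      have "ereal (- G f) = ereal (f x - G f) - ereal (f x)" by simp
      also have "\<dots> \<le> GX_star D G x - ereal (f x)"
        using GX by (intro ereal_minus_mono) auto
      also have "\<dots> < GX_star D G z - ereal (f z)"
        using f(2) 2 by (simp add: exposing_hyperplane_def)
      finally have "ereal (f z - G f) < GX_star D G z"
        by (cases "GX_star D G z") auto
      then obtain h where "h \<in> D" "f z - G f < h z - G h"
        unfolding GX_star_def less_SUP_iff by auto
      then show ?thesis using \<phi>
        by (intro bexI[of _ h] bexI[of _ \<phi>]) auto
    qed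
  qed
  have obs: "observable (U' \<times> V)" using A by (rule observable_openin)
  have total: "\<forall>\<^sub>F n in sequentially.
      mass f \<phi> UNIV n \<le> mass f \<phi> (U' \<times> V) n + mass f \<phi> (- (U' \<times> V)) n"
    using eventually_ge_at_top[of 1]
  proof eventually_elim
    case (elim n)
    show ?case
      using mass_Un_le[OF fd \<phi> obs observable_Compl[OF obs] elim] by (simp add: Compl_partition)
  qed
  have "\<forall>\<^sub>F n in sequentially. ennreal (exp (real n * (c + (f x + e)))) < mass f \<phi> (U' \<times> V) n"
    by (rule eventually_exp_less_dominant[OF mass_UNIV_tendsto[OF f(1) \<phi>] total small])
      (use e in \<open>simp add: e_def field_simps\<close>)
  then show ?thesis using eventually_ge_at_top[of 1]
  proof eventually_elim
    case (elim n)
    have "mass f \<phi> (U' \<times> V) n \<le> ennreal (exp (real n * (f x + e))) * mass (\<lambda>_. 0) (\<lambda>_. 0) (U' \<times> V) n"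
    proof (rule mass_tilt_le[OF zero_in_topological_dual zero_in_bcontfun elim(2) obs])
      fix z v assume "(z, v) \<in> U' \<times> V"
      then show "f z + \<phi> v \<le> 0 + 0 + (f x + e)"
        using \<phi>le[of v] by (simp add: U'_def)
    qed
    also have "\<dots> \<le> ennreal (exp (real n * (f x + e))) * mass (\<lambda>_. 0) (\<lambda>_. 0) (U \<times> V) n"
      by (intro mult_left_mono mass_mono) (auto simp: U'_def)
    finally have "ennreal (exp (real n * (f x + e))) * ennreal (exp (real n * c)) <
        ennreal (exp (real n * (f x + e))) * mass (\<lambda>_. 0) (\<lambda>_. 0) (U \<times> V) n"
      using elim(1) by (simp add: ennreal_mult'[symmetric] exp_add[symmetric] algebra_simps)
    then show ?case
      \<comment> \<open>The common factor \<open>exp (n (f x + e))\<close> is cancelled by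
        contraposition.\<close>
      by (meson leD leI mult_left_mono zero_le)
  qed
qed

text \<open>It suffices to treat one point \<open>(x, y)\<close> of \<open>W\<close> in a product
  neighbourhood. There \<open>x\<close> is replaced by a nearby exposed point at which
  \<open>GX_star\<close> is still below the required level; \<open>y\<close> stays fixed.\<close>

lemma lower_bound:
  assumes "D \<noteq> {}"
    and approx: "\<And>x. GX_star D G x < \<infinity> \<Longrightarrow> \<exists>xs. (\<forall>k::nat. xs k \<in> exposed_set D G) \<and>
      limitin weak_topology xs x sequentially \<and> (\<lambda>k. GX_star D G (xs k)) \<longlonglongrightarrow> GX_star D G x"
    and W: "openin pair_topology W"
  shows "- (INF z\<in>W. rate z) \<le> liminf (log_prob_rate M (\<lambda>n \<omega>. (X n \<omega>, Y n \<omega>)) W)" (is "_ \<le> ?l")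
proof -
  have "- rate z \<le> ?l" if z: "z \<in> W" for z
  proof (rule dense_le)
    obtain x y where xy: "z = (x, y)" by (cases z)
    fix e assume "e < - rate z"
    then obtain c where c: "e < ereal c" "ereal c < - (GX_star D G x + IY J y)"
      using ereal_dense2 xy by auto
    have fin: "GX_star D G x + IY J y < ereal (- c)"
      using c(2) ereal_less_uminus_reorder[of "ereal c"] by simp
    have "GX_star D G x \<noteq> -\<infinity>" "IY J y \<noteq> -\<infinity>"
    proof -
      obtain f where "f \<in> D" using assms(1) by blast
      then have "ereal (f x - G f) \<le> GX_star D G x" unfolding GX_star_def by (rule SUP_upper)
      then show "GX_star D G x \<noteq> -\<infinity>" by auto
      have "ereal (0 - J (\<lambda>_. 0)) \<le> IY J y"
        unfolding IY_def using zero_in_bcontfun by (rule SUP_upper2) simp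
      then show "IY J y \<noteq> -\<infinity>" by auto
    qed
    \<comment> \<open>Neither summand is \<open>-\<infinity>\<close> and their sum is below a real
      number, so both are finite.\<close>
    with fin obtain b where b: "IY J y = ereal b" "GX_star D G x < ereal (- c - b)"
      by (cases "GX_star D G x"; cases "IY J y") auto
    have "(x, y) \<in> W" using z xy by simp
    from W[unfolded openin_prod_topology_alt, rule_format, OF this]
    obtain U V where UV: "openin weak_topology U" "open V" "x \<in> U" "y \<in> V" "U \<times> V \<subseteq> W"
      by auto
    have "GX_star D G x < \<infinity>" using b(2) by (rule less_le_trans) simp
    then obtain xs where xs: "\<forall>k::nat. xs k \<in> exposed_set D G"
      "limitin weak_topology xs x sequentially" "(\<lambda>k. GX_star D G (xs k)) \<longlonglongrightarrow> GX_star D G x"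
      using approx by blast
    have "\<forall>\<^sub>F k in sequentially. xs k \<in> U"
      using xs(2) UV(1,3) by (simp add: limitin_def)
    moreover have "\<forall>\<^sub>F k in sequentially. GX_star D G (xs k) < ereal (- c - b)"
      using xs(3) b(2) by (rule order_tendstoD(2))
    ultimately have "\<forall>\<^sub>F k in sequentially. xs k \<in> U \<and> GX_star D G (xs k) < ereal (- c - b)"
      by (rule eventually_conj)
    then obtain k where k: "xs k \<in> U" "GX_star D G (xs k) < ereal (- c - b)"
      by (auto simp: eventually_sequentially)
    have "\<forall>\<^sub>F n in sequentially. ennreal (exp (real n * c)) < mass (\<lambda>_. 0) (\<lambda>_. 0) (U \<times> V) n"
      by (rule lower_bound_exposed[OF _ UV(1) k(1) UV(2,4) b(1) k(2)]) (use xs(1) in blast)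
    then have "\<forall>\<^sub>F n in sequentially. ereal c \<le> log_prob_rate M (\<lambda>n \<omega>. (X n \<omega>, Y n \<omega>)) W n"
      using eventually_ge_at_top[of 1]
    proof eventually_elim
      case (elim n)
      have "ennreal (exp (real n * c)) < mass (\<lambda>_. 0) (\<lambda>_. 0) W n"
        using elim(1) mass_mono[OF UV(5)] by (rule less_le_trans)
      then show ?case
        using elim(2) less_rate_iff[OF elim(2)]
        by (simp add: mass_0_eq_emeasure observable_openin[OF W] less_imp_le)
    qed
    then have "ereal c \<le> ?l" by (rule Liminf_bounded)
    then show "e \<le> ?l" using c(1) by simp
  qed
  then have "- ?l \<le> (INF z\<in>W. rate z)"
    by (intro INF_greatest) (meson ereal_uminus_le_reorder)
  then show ?thesis by (simp add: ereal_uminus_le_reorder)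
qed

text \<open>Sublevel sets are intersections of closed conditions, one for each pair of tilts. They
  are compact because the lower bound on the complement of a large compact set forces the rate to be
  large there.\<close>

lemma good_rate:
  assumes "D \<noteq> {}"
    and approx: "\<And>x. GX_star D G x < \<infinity> \<Longrightarrow> \<exists>xs. (\<forall>k::nat. xs k \<in> exposed_set D G) \<and>
      limitin weak_topology xs x sequentially \<and> (\<lambda>k. GX_star D G (xs k)) \<longlonglongrightarrow> GX_star D G x"
  shows "good_rate_function pair_topology rate"
  unfolding good_rate_function_def
proof (intro conjI ballI allI)
  fix z :: "'a \<times> 'b"
  have "- (INF z\<in>UNIV. rate z) \<le> liminf (log_prob_rate M (\<lambda>n \<omega>. (X n \<omega>, Y n \<omega>)) UNIV)"
    using openin_topspace[of "pair_topology :: ('a \<times> 'b) topology"]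
    by (intro lower_bound[OF assms]) auto
  also have "\<dots> = 0"
    by (simp add: emeasure_space_1 elog_def Liminf_const flip: zero_ereal_def)
  finally have "0 \<le> (INF z\<in>UNIV. rate z)" by (simp add: ereal_uminus_le_0_iff)
  also have "\<dots> \<le> rate z" by (rule INF_lower) simp
  finally show "0 \<le> rate z" .
next
  fix a :: real
  let ?S = "{z \<in> topspace pair_topology. rate z \<le> ereal a}"
  have "?S = (\<Inter>(h, \<psi>) \<in> D \<times> bcontfun.
      {z \<in> topspace pair_topology. h (fst z) + \<psi> (snd z) \<in> {.. a + (G h + J \<psi>)}})"
    using GX_star_plus_IY_le_iff[OF assms(1), of G _ J _ a] by (fastforce simp: algebra_simps)
  also have "closedin pair_topology \<dots>"
  proof (rule closedin_INT)
    show "D \<times> (bcontfun :: ('b \<Rightarrow> real) set) \<noteq> {}" using assms(1) zero_in_bcontfun by blast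
    fix p assume "p \<in> D \<times> (bcontfun :: ('b \<Rightarrow> real) set)"
    moreover obtain h \<psi> where "p = (h, \<psi>)" by (cases p)
    ultimately show "closedin pair_topology (case p of (h, \<psi>) \<Rightarrow>
        {z \<in> topspace pair_topology. h (fst z) + \<psi> (snd z) \<in> {.. a + (G h + J \<psi>)}})"
      using closedin_continuous_map_preimage[OF continuous_map_pair_topology[of h \<psi>],
          of "{.. a + (G h + J \<psi>)}"] D_dual by auto
  qed
  finally show cl: "closedin pair_topology ?S" .
  show "compactin pair_topology ?S"
  \<comment> \<open>A point of a nonempty sublevel set yields an exposed point, hence a Hausdorff
    weak topology. Then \<open>K \<times> L\<close> is closed and the lower bound applies to its
    complement.\<close>
  proof (cases "?S = {}")
    case True
    then show ?thesis by (simp only: compactin_empty)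
  next
    case False
    then obtain x y where "GX_star D G x + IY J y \<le> ereal a" by auto
    then have "GX_star D G x < \<infinity>" by auto
    then obtain x' where "x' \<in> exposed_set D G" using approx by blast
    then have H: "Hausdorff_space (weak_topology :: 'a topology)"
      using D_dual by (rule Hausdorff_weak_topology_if_exposed)
    obtain K L where KL: "compactin weak_topology K" "compactin euclidean L"
      "observable (- (K \<times> L))" "exp_below (mass (\<lambda>_. 0) (\<lambda>_. 0) (- (K \<times> L))) (- a)"
      using compact_tail by blast
    have "closedin weak_topology K" using H KL(1) by (rule compactin_imp_closedin)
    moreover have "closed L" using KL(2) by (simp add: compact_imp_closed)
    ultimately have "closedin pair_topology (K \<times> L)"
      by (simp add: closedin_prod_Times_iff)
    then have op: "openin pair_topology (- (K \<times> L))"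
      by (simp add: closedin_def Compl_eq_Diff_UNIV)
    have "exp_below (\<lambda>n. emeasure M {\<omega> \<in> space M. (X n \<omega>, Y n \<omega>) \<in> - (K \<times> L)}) (- a)"
      using KL(4) by (rule exp_below_mono)
        (auto intro!: eventually_sequentiallyI[of 1] simp: mass_0_eq_emeasure[OF KL(3)] simp del: Compl_iff)
    then have "limsup (log_prob_rate M (\<lambda>n \<omega>. (X n \<omega>, Y n \<omega>)) (- (K \<times> L))) < ereal (- a)"
      by (simp only: exp_below_iff_limsup)
    \<comment> \<open>The lower bound and the tail estimate squeeze the infimum: it must exceed
      \<open>a\<close>.\<close>
    then have "- (INF z\<in>- (K \<times> L). rate z) < ereal (- a)"
      using lower_bound[OF assms op] Liminf_le_Limsup[OF trivial_limit_sequentially]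
      by (meson le_less_trans)
    then have "ereal a < (INF z\<in>- (K \<times> L). rate z)"
      by (metis ereal_minus_less_minus uminus_ereal.simps(1))
    then have "z \<in> K \<times> L" if "z \<in> ?S" for z
      using that INF_lower[of z "- (K \<times> L)" rate]
      by (metis (mono_tags, lifting) ComplI leD less_le_trans mem_Collect_eq)
    then have "?S \<subseteq> K \<times> L" by blast
    moreover have "compactin pair_topology (K \<times> L)"
      using KL(1,2) by (simp add: compactin_Times)
    ultimately show ?thesis using cl closed_compactin by blast
  qed
qed

end

theorem theorem3p1:
  fixes M :: "'w measure"
    and X :: "nat \<Rightarrow> 'w \<Rightarrow> 'a::hausdorff_tvs"
    and Y :: "nat \<Rightarrow> 'w \<Rightarrow> 'b::hausdorff_tvs"
    and D :: "('a \<Rightarrow> real) set"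
    and G :: "('a \<Rightarrow> real) \<Rightarrow> real"
    and J :: "('b \<Rightarrow> real) \<Rightarrow> real"
  assumes "prob_space M"
    and "\<And>n. n \<ge> 1 \<Longrightarrow> random_element M weak_topology (X n)"
    and "\<And>n. n \<ge> 1 \<Longrightarrow> random_element M euclidean (Y n)"
    and "\<And>n. n \<ge> 1 \<Longrightarrow>
           random_element M (prod_topology weak_topology euclidean) (\<lambda>\<omega>. (X n \<omega>, Y n \<omega>))"
    and "exponentially_tight M weak_topology X"
    and "exponentially_tight M euclidean Y"
    and "D \<subseteq> topological_dual"
    and "\<And>f \<phi>. f \<in> D \<Longrightarrow> \<phi> \<in> bcontfun \<Longrightarrow>
           (\<lambda>n. ereal (1 / real n) *
              elog (\<integral>\<^sup>+ \<omega>. ennreal (exp (real n * f (X n \<omega>) + real n * \<phi> (Y n \<omega>))) \<partial>M))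
           \<longlonglongrightarrow> ereal (G f + J \<phi>)"
    and "\<And>x. GX_star D G x < \<infinity> \<Longrightarrow>
           \<exists>xs. (\<forall>k::nat. xs k \<in> exposed_set D G) \<and>
                limitin weak_topology xs x sequentially \<and>
                (\<lambda>k. GX_star D G (xs k)) \<longlonglongrightarrow> GX_star D G x"
  shows "good_rate_function (prod_topology weak_topology euclidean)
           (\<lambda>(x, y). GX_star D G x + IY J y) \<and>
         satisfies_LDP M (prod_topology weak_topology euclidean)
           (\<lambda>n \<omega>. (X n \<omega>, Y n \<omega>)) (\<lambda>(x, y). GX_star D G x + IY J y)"
proof -
  interpret prob_space M by (rule assms(1))
  interpret asymptotically_independent_pair M X Y D G J
    by unfold_locales (use assms in auto)
  \<comment> \<open>Over empty \<open>D\<close> the supremum \<open>GX_star\<close> is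
    \<open>-\<infinity>\<close>, so the approximation hypothesis would demand exposed points, whose
    hyperplanes must come from \<open>D\<close>.\<close>
  have "D \<noteq> {}"
  proof
    assume "D = {}"
    then have "GX_star D G 0 < \<infinity>" by (simp add: GX_star_def bot_ereal_def)
    then have "exposed_set D G \<noteq> {}" using assms(9) by blast
    then show False using \<open>D = {}\<close> by (simp add: exposed_set_def)
  qed
  then show ?thesis
    unfolding satisfies_LDP_def
    using good_rate assms(9) upper_bound lower_bound by simp
qed

end
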